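(* Let $\mathcal{X}\subseteq\{0,1\}^n$, let $\mathcal{X}(\bm{x})\subseteq\{0,1\}^n$ for each $\bm{x}\in\mathcal{X}$, let $\mathcal{U}$ be a compact convex set, and let $f(\bm{y},\bm{c})$ be a real-valued function that is linear in $\bm{y}\in\mathbb{R}^n$ and concave in $\bm{c}\in\mathcal{U}$. Then the recoverable robust problem \[ \min_{\bm{x}\in\mathcal{X}} \max_{\bm{c}\in\mathcal{U}} \min_{\bm{y}\in\mathcal{X}(\bm{x})} f(\bm{y},\bm{c}) \] is equivalent to \[ \min_{\substack{\bm{x}\in\mathcal{X},\\ \bm{y}^{(1)},\ldots,\bm{y}^{(n+1)}\in\mathcal{X}(\bm{x})}} \max_{\bm{c}\in\mathcal{U}} \min_{i=1,\ldots,n+1} f(\bm{y}^{(i)},\bm{c}), \] i.e. the two problems have the same optimal value.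
   Context: $\mathcal{X}$ is the set of feasible first-stage solutions, and $\mathcal{X}(\bm{x})$ is the set of feasible second-stage (recovery) solutions given the first-stage solution $\bm{x}$. $\mathcal{U}$ is a nonempty subset of a finite-dimensional real vector space. A maximum is read as a supremum if it is not attained, and a minimum over an empty set is $+\infty$. The vectors $\bm{y}^{(1)},\dots,\bm{y}^{(n+1)}$ need not be distinct. *)

theory Defs
  imports "HOL-Analysis.Analysis"
begin

definition binary_vectors :: "(real ^ 'n) set" where
  "binary_vectors = {x. \<forall>i. x $ i \<in> {0, 1}}"

text \<open>
  Optimal values live in \<^typ>\<open>ereal\<close>: an infimum over the empty set is \<open>\<infinity>\<close>, and suprema need
  not be attained.  For sets of binary vectors all infima below range over finite sets, so they are
  minima when the range is nonempty.
\<close>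

definition recoverable_value ::
  "(real ^ 'n) set \<Rightarrow> (real ^ 'n \<Rightarrow> (real ^ 'n) set) \<Rightarrow> 'c set \<Rightarrow> (real ^ 'n \<Rightarrow> 'c \<Rightarrow> real) \<Rightarrow> ereal"
  where
  "recoverable_value X R U f = (INF x\<in>X. SUP c\<in>U. INF y\<in>R x. ereal (f y c))"

definition k_adaptable_value ::
  "nat \<Rightarrow> (real ^ 'n) set \<Rightarrow> (real ^ 'n \<Rightarrow> (real ^ 'n) set) \<Rightarrow> 'c set \<Rightarrow> (real ^ 'n \<Rightarrow> 'c \<Rightarrow> real) \<Rightarrow> ereal"
  where
  "k_adaptable_value k X R U f =
     (INF (x, y) \<in> (SIGMA x:X. {1..k} \<rightarrow>\<^sub>E R x).
        SUP c\<in>U. INF i\<in>{1..k}. ereal (f (y i) c))"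

end

theory Submission imports Defs begin

text \<open>
  Fix \<open>x\<close> and let \<open>v\<close> be the value of the inner max-min problem.  Separating the set of vectors
  strictly below some \<open>(f y c - v)\<^sub>y\<close> from the nonnegative orthant yields a point \<open>p\<close> in the convex
  hull of \<open>R x\<close> with \<open>f p c \<le> v\<close> for all \<open>c\<close>.  By Caratheodory's theorem \<open>p\<close> is a convex
  combination of \<open>n + 1\<close> points of \<open>R x\<close>, and the minimum of \<open>f\<close> over these points is at most
  \<open>f p c\<close>.
\<close>

text \<open>A theorem of the alternative: the multipliers are the coordinates of the normal of a
  hyperplane separating \<open>S\<close> from \<open>T\<close>, scaled to sum to 1.\<close>

lemma concave_family_multipliers:
  fixes g :: "'k::finite \<Rightarrow> 'c::real_vector \<Rightarrow> real" and v :: real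
  assumes "U \<noteq> {}" and conc: "\<And>k. concave_on U (g k)"
    and le: "\<And>c. c \<in> U \<Longrightarrow> \<exists>k. g k c \<le> v"
  obtains l :: "'k \<Rightarrow> real" where "\<And>k. 0 \<le> l k" and "sum l UNIV = 1"
    and "\<And>c. c \<in> U \<Longrightarrow> (\<Sum>k\<in>UNIV. l k * g k c) \<le> v"
proof -
  \<comment> \<open>\<open>S\<close> is convex because the \<open>g k\<close> are concave, and the
    strict inequality makes \<open>le\<close> say exactly that \<open>S\<close> misses the orthant
    \<open>T\<close>.\<close>
  define S where "S = {z :: real ^ 'k. \<exists>c\<in>U. \<forall>k. z $ k < g k c - v}"
  define T where "T = {z :: real ^ 'k. \<forall>k. 0 \<le> z $ k}"
  have "convex U"
    using conc concave_on_imp_convex by blast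
  have "convex S"
    unfolding convex_alt
  proof (intro ballI allI impI)
    fix z w :: "real ^ 'k" and t :: real
    assume "z \<in> S" "w \<in> S" and t: "0 \<le> t \<and> t \<le> 1"
    then obtain c d where c: "c \<in> U" "\<And>k. z $ k < g k c - v"
      and d: "d \<in> U" "\<And>k. w $ k < g k d - v"
      unfolding S_def by blast
    have "((1 - t) *\<^sub>R z + t *\<^sub>R w) $ k < g k ((1 - t) *\<^sub>R c + t *\<^sub>R d) - v" for k
    proof -
      have "(1 - t) * z $ k + t * w $ k < (1 - t) * (g k c - v) + t * (g k d - v)"
      \<comment> \<open>Strictness has to come from a summand of positive weight: the first one if
        \<open>t = 0\<close>, the second one otherwise.\<close>
      proof (cases "t = 0")
        case True
        then show ?thesis using c(2)[of k] by simp
      next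
        case False
        then show ?thesis
          using t c(2)[of k] d(2)[of k]
          by (intro add_le_less_mono mult_left_mono mult_strict_left_mono) auto
      qed
      also have "\<dots> = (1 - t) * g k c + t * g k d - v"
        by (simp add: algebra_simps)
      also have "\<dots> \<le> g k ((1 - t) *\<^sub>R c + t *\<^sub>R d) - v"
        using concave_onD[OF conc[of k], of t c d] t c(1) d(1) by simp
      finally show ?thesis by simp
    qed
    moreover have "(1 - t) *\<^sub>R c + t *\<^sub>R d \<in> U"
      using \<open>convex U\<close> c(1) d(1) t by (simp add: convex_alt)
    ultimately show "(1 - t) *\<^sub>R z + t *\<^sub>R w \<in> S"
      unfolding S_def by blast
  qed
  have "convex T"
    unfolding T_def convex_def by auto
  \<comment> \<open>The vector of the values \<open>g k c - v\<close> need not lie in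
    \<open>S\<close> itself, so it is approached from below by a uniform shift
    \<open>e\<close>.\<close>
  have below: "(\<chi> k. g k c - v - e) \<in> S" if "c \<in> U" "0 < e" for c and e :: real
    using that unfolding S_def by (auto intro!: bexI[of _ c])
  have "S \<noteq> {}"
    using below[of _ 1] \<open>U \<noteq> {}\<close> by auto
  moreover have "0 \<in> T"
    by (simp add: T_def)
  moreover have "S \<inter> T = {}"
  proof -
    have False if "z \<in> S" "z \<in> T" for z
    proof -
      from that(1) obtain c where "c \<in> U" and c: "\<And>k. z $ k < g k c - v"
        unfolding S_def by blast
      then obtain k where "g k c \<le> v"
        using le by blast
      with c[of k] that(2) show False
        unfolding T_def by (smt (verit) mem_Collect_eq)
    qed
    then show ?thesis by blast
  qed
  ultimately obtain a b where "a \<noteq> 0" and aS: "\<And>z. z \<in> S \<Longrightarrow> a \<bullet> z \<le> b"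
    and aT: "\<And>z. z \<in> T \<Longrightarrow> b \<le> a \<bullet> z"
    using separating_hyperplane_sets[OF \<open>convex S\<close> \<open>convex T\<close>] by blast
  have "b \<le> 0"
    using aT[OF \<open>0 \<in> T\<close>] by simp
  have a_nonneg: "0 \<le> a $ k" for k
  proof (rule ccontr)
    assume neg: "\<not> 0 \<le> a $ k"
    \<comment> \<open>\<open>T\<close> contains the whole ray along axis \<open>k\<close>; this
      \<open>s\<close> is the point on it where the inner product with \<open>a\<close> would be
      \<open>b - 1\<close>, below the bound \<open>b\<close>.\<close>
    define s where "s = (b - 1) / a $ k"
    have "0 \<le> s"
      using neg \<open>b \<le> 0\<close> by (auto simp: s_def divide_nonpos_neg)
    then have "axis k s \<in> T"
      by (auto simp: T_def axis_def)
    from aT[OF this] have "b \<le> a $ k * s"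
      by (simp add: inner_axis)
    then show False
      using neg by (simp add: s_def)
  qed
  define A where "A = (\<Sum>k\<in>UNIV. a $ k)"
  have "A \<noteq> 0"
    using \<open>a \<noteq> 0\<close> a_nonneg by (simp add: A_def sum_nonneg_eq_0_iff vec_eq_iff)
  then have "0 < A"
    using a_nonneg sum_nonneg[of UNIV "($) a"] by (simp add: A_def order.not_eq_order_implies_strict)
  have "(\<Sum>k\<in>UNIV. a $ k * g k c) \<le> v * A" if "c \<in> U" for c
  proof (rule field_le_epsilon)
    fix e :: real
    assume "0 < e"
    \<comment> \<open>Shifting every coordinate by \<open>d\<close> changes the inner product with
      \<open>a\<close> by \<open>d * A\<close>, which this choice makes equal to
      \<open>e\<close>.\<close>
    define d where "d = e / A"
    have "0 < d" and d: "d * A = e"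
      using \<open>0 < e\<close> \<open>0 < A\<close> by (simp_all add: d_def)
    have "a \<bullet> (\<chi> k. g k c - v - d) \<le> 0"
      using aS[OF below[OF that \<open>0 < d\<close>]] \<open>b \<le> 0\<close> by linarith
    moreover have "a \<bullet> (\<chi> k. g k c - v - d) = (\<Sum>k\<in>UNIV. a $ k * g k c) - v * A - d * A"
      by (simp add: inner_vec_def A_def right_diff_distrib sum_subtractf sum_distrib_left
          mult.commute)
    ultimately show "(\<Sum>k\<in>UNIV. a $ k * g k c) \<le> v * A + e"
      using d by linarith
  qed
  then have "(\<Sum>k\<in>UNIV. a $ k / A * g k c) \<le> v" if "c \<in> U" for c
    using that \<open>0 < A\<close> by (simp add: sum_divide_distrib[symmetric] pos_divide_le_eq)
  moreover have "(\<Sum>k\<in>UNIV. a $ k / A) = 1"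
    using \<open>A \<noteq> 0\<close> by (simp add: sum_divide_distrib[symmetric] A_def)
  ultimately show ?thesis
    using that[of "\<lambda>k. a $ k / A"] a_nonneg \<open>0 < A\<close> by simp
qed

text \<open>Caratheodory gives at most \<open>n + 1\<close> points, while the tuples have exactly
  \<open>n + 1\<close> entries; the surplus indices repeat one element.\<close>

lemma finite_nonempty_set_enumeration:
  assumes "finite A" "A \<noteq> {}" "card A \<le> k"
  obtains e where "e \<in> {1..k} \<rightarrow>\<^sub>E A" and "e ` {1..k} = A"
proof -
  obtain h where h: "bij_betw h {1..card A} A"
    using ex_bij_betw_nat_finite_1[OF assms(1)] by blast
  obtain a where "a \<in> A"
    using assms(2) by blast
  define e where "e = (\<lambda>i\<in>{1..k}. if i \<le> card A then h i else a)"
  have "e \<in> {1..k} \<rightarrow>\<^sub>E A"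
    using bij_betwE[OF h] \<open>a \<in> A\<close> by (auto simp: e_def)
  moreover have "A \<subseteq> e ` {1..k}"
  proof
    fix y
    assume "y \<in> A"
    then obtain i where "i \<in> {1..card A}" "y = h i"
      using bij_betw_imp_surj_on[OF h] by blast
    then show "y \<in> e ` {1..k}"
      using assms(3) by (intro image_eqI[of _ _ i]) (auto simp: e_def)
  qed
  ultimately show ?thesis
    using that by blast
qed

text \<open>The multipliers turn the family into one point \<open>p\<close> that is good for every
  \<open>c\<close> at once. Since \<open>p\<close> does not depend on \<open>c\<close>, neither does
  the set \<open>s\<close> that Caratheodory extracts from it. The family is indexed by a finite
  type because the separation takes place in \<open>real ^ 'k\<close>.\<close>

lemma small_subset_minimax:
  fixes y :: "'k::finite \<Rightarrow> 'a::euclidean_space" and U :: "'c::real_vector set"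
    and f :: "'a \<Rightarrow> 'c \<Rightarrow> real"
  assumes "U \<noteq> {}"
    and lin: "\<And>c. c \<in> U \<Longrightarrow> linear (\<lambda>p. f p c)"
    and conc: "\<And>k. concave_on U (f (y k))"
    and le: "\<And>c. c \<in> U \<Longrightarrow> \<exists>k. f (y k) c \<le> v"
  obtains s where "finite s" "s \<subseteq> range y" "s \<noteq> {}" "card s \<le> DIM('a) + 1"
    and "\<And>c. c \<in> U \<Longrightarrow> \<exists>p\<in>s. f p c \<le> v"
proof -
  obtain l :: "'k \<Rightarrow> real" where l: "\<And>k. 0 \<le> l k" "sum l UNIV = 1"
    and l_le: "\<And>c. c \<in> U \<Longrightarrow> (\<Sum>k\<in>UNIV. l k * f (y k) c) \<le> v"
    using concave_family_multipliers[of U "\<lambda>k. f (y k)" v] assms by blast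
  define p where "p = (\<Sum>k\<in>UNIV. l k *\<^sub>R y k)"
  have p_le: "f p c \<le> v" if "c \<in> U" for c
    using l_le[OF that]
    by (simp add: p_def linear_sum[OF lin[OF that]] linear_cmul[OF lin[OF that]])
  have "p \<in> convex hull (range y)"
    unfolding p_def by (rule convex_sum) (simp_all add: l hull_inc)
  then obtain s u where s: "finite s" "s \<subseteq> range y" "card s \<le> DIM('a) + 1"
    and u: "\<forall>q\<in>s. 0 \<le> u q" "sum u s = 1" "(\<Sum>q\<in>s. u q *\<^sub>R q) = p"
    unfolding convex_hull_caratheodory by blast
  have "\<exists>q\<in>s. f q c \<le> v" if "c \<in> U" for c
  proof (rule ccontr)
    assume "\<not> (\<exists>q\<in>s. f q c \<le> v)"
    then have gt: "\<And>q. q \<in> s \<Longrightarrow> v < f q c"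
      by force
    \<comment> \<open>The weights sum to 1, so some weight is positive; at that point the comparison
      of the two weighted sums is strict.\<close>
    obtain q where q: "q \<in> s" "u q \<noteq> 0"
      using u(2) by (metis sum.neutral zero_neq_one)
    have "(\<Sum>q\<in>s. u q * v) < (\<Sum>q\<in>s. u q * f q c)"
    proof (rule sum_strict_mono_ex1[OF s(1)])
      show "\<forall>q\<in>s. u q * v \<le> u q * f q c"
        using u(1) gt by (simp add: mult_left_mono less_imp_le)
      have "0 < u q"
        using u(1) q by force
      then show "\<exists>q\<in>s. u q * v < u q * f q c"
        using mult_strict_left_mono[OF gt[OF q(1)]] q(1) by blast
    qed
    moreover have "(\<Sum>q\<in>s. u q * v) = v"
      using u(2) by (simp add: sum_distrib_right[symmetric])
    moreover have "(\<Sum>q\<in>s. u q * f q c) = f p c"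
      by (simp add: u(3)[symmetric] linear_sum[OF lin[OF that]] linear_cmul[OF lin[OF that]])
    ultimately show False
      using p_le[OF that] by simp
  qed
  moreover have "s \<noteq> {}"
    using u(2) by auto
  ultimately show ?thesis
    using that s by blast
qed

lemma binary_vectors_eq_range:
  "(binary_vectors :: (real ^ 'n) set) = range (\<lambda>I. \<chi> i. if i \<in> I then 1 else 0)"
proof (intro equalityI subsetI)
  fix x :: "real ^ 'n"
  assume "x \<in> binary_vectors"
  then show "x \<in> range (\<lambda>I. \<chi> i. if i \<in> I then 1 else 0)"
    unfolding binary_vectors_def
    by (intro range_eqI[of _ _ "{i. x $ i = 1}"]) (auto simp: vec_eq_iff)
qed (auto simp: binary_vectors_def)

text \<open>This provides the finite index type for \<open>small_subset_minimax\<close>: subsets of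
  \<open>'n\<close> stand for their indicator vectors, and those with a vector outside
  \<open>Y\<close> are sent to a fixed \<open>a\<close> in \<open>Y\<close>.\<close>

lemma binary_subset_eq_range:
  assumes "Y \<subseteq> (binary_vectors :: (real ^ 'n) set)" "Y \<noteq> {}"
  obtains y :: "'n set \<Rightarrow> real ^ 'n" where "range y = Y"
proof -
  obtain a where "a \<in> Y"
    using assms(2) by blast
  define b :: "'n set \<Rightarrow> real ^ 'n" where "b = (\<lambda>I. \<chi> i. if i \<in> I then 1 else 0)"
  have "range (\<lambda>I. if b I \<in> Y then b I else a) = Y"
    using assms(1) \<open>a \<in> Y\<close> unfolding binary_vectors_eq_range b_def[symmetric] by force
  then show ?thesis
    using that by blast
qed

theorem theorem1:
  fixes X :: "(real ^ 'n) set"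
    and R :: "real ^ 'n \<Rightarrow> (real ^ 'n) set"
    and U :: "'c::euclidean_space set"
    and f :: "real ^ 'n \<Rightarrow> 'c \<Rightarrow> real"
  assumes "X \<subseteq> binary_vectors"
    and "\<And>x. x \<in> X \<Longrightarrow> R x \<subseteq> binary_vectors"
    and "U \<noteq> {}" and "compact U" and "convex U"
    and "\<And>c. c \<in> U \<Longrightarrow> linear (\<lambda>y. f y c)"
    and "\<And>y. y \<in> binary_vectors \<Longrightarrow> concave_on U (f y)"
  shows "recoverable_value X R U f = k_adaptable_value (CARD('n) + 1) X R U f"
proof (rule antisym)
  show "recoverable_value X R U f \<le> k_adaptable_value (CARD('n) + 1) X R U f"
    unfolding recoverable_value_def k_adaptable_value_def
  proof (rule INF_greatest, clarify)
    fix x and y :: "nat \<Rightarrow> real ^ 'n"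
    assume "x \<in> X" and y: "y \<in> {1..CARD('n) + 1} \<rightarrow>\<^sub>E R x"
    \<comment> \<open>The entries of the tuple lie in \<open>R x\<close>, so for each
      \<open>c\<close> their minimum runs over fewer points.\<close>
    have "(SUP c\<in>U. INF p\<in>R x. ereal (f p c))
        \<le> (SUP c\<in>U. INF i\<in>{1..CARD('n) + 1}. ereal (f (y i) c))"
      using y by (intro SUP_mono' INF_greatest INF_lower) auto
    then show "(INF x\<in>X. SUP c\<in>U. INF p\<in>R x. ereal (f p c))
        \<le> (SUP c\<in>U. INF i\<in>{1..CARD('n) + 1}. ereal (f (y i) c))"
      by (rule INF_lower2[OF \<open>x \<in> X\<close>])
  qed
next
  show "k_adaptable_value (CARD('n) + 1) X R U f \<le> recoverable_value X R U f"
    unfolding recoverable_value_def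
  proof (rule INF_greatest)
    fix x
    assume "x \<in> X"
    show "k_adaptable_value (CARD('n) + 1) X R U f \<le> (SUP c\<in>U. INF p\<in>R x. ereal (f p c))"
    proof (cases "R x = {}")
      case True
      then show ?thesis
        \<comment> \<open>The inner infimum is infinite for each \<open>c\<close>; a supremum over
          an empty \<open>U\<close> would be minus infinity instead.\<close>
        using \<open>U \<noteq> {}\<close> by (simp add: top_ereal_def)
    next
      case False
      then obtain b :: "'n set \<Rightarrow> real ^ 'n" where b: "range b = R x"
        using binary_subset_eq_range assms(2)[OF \<open>x \<in> X\<close>] by blast
      show ?thesis
      \<comment> \<open>Comparing real upper bounds \<open>v\<close> avoids a case split on infinite
        values and on whether the supremum is attained.\<close>
      proof (rule ereal_le_real)
        fix v
        assume v: "(SUP c\<in>U. INF p\<in>R x. ereal (f p c)) \<le> ereal v"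
        have "\<exists>k. f (b k) c \<le> v" if "c \<in> U" for c
        proof (rule ccontr)
          assume "\<not> (\<exists>k. f (b k) c \<le> v)"
          then have "ereal v < (INF k. ereal (f (b k) c))"
            \<comment> \<open>Finiteness of the index type matters here: an infinite family could
              lie strictly above \<open>v\<close> and still have infimum \<open>v\<close>.\<close>
            by (subst finite_less_Inf_iff) (auto simp: not_le)
          moreover have "(INF k. ereal (f (b k) c)) \<le> ereal v"
            using v that by (simp add: SUP_le_iff b[symmetric] image_image)
          ultimately show False by simp
        qed
        moreover have "concave_on U (f (b k))" for k
          using b assms(2)[OF \<open>x \<in> X\<close>] assms(7) by blast
        ultimately obtain s where s: "finite s" "s \<subseteq> R x" "s \<noteq> {}" "card s \<le> CARD('n) + 1"
          and s_le: "\<And>c. c \<in> U \<Longrightarrow> \<exists>p\<in>s. f p c \<le> v"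
          using small_subset_minimax[of U f b v, OF assms(3,6)]
          unfolding b DIM_cart DIM_real mult_1_right by metis
        obtain y where y: "y \<in> {1..CARD('n) + 1} \<rightarrow>\<^sub>E s" "y ` {1..CARD('n) + 1} = s"
          using finite_nonempty_set_enumeration[OF s(1,3,4)] by blast
        have "(INF i\<in>{1..CARD('n) + 1}. ereal (f (y i) c)) \<le> ereal v" if "c \<in> U" for c
        proof -
          from s_le[OF that] y(2) obtain i where "i \<in> {1..CARD('n) + 1}" "f (y i) c \<le> v"
            by blast
          then show ?thesis
            by (intro INF_lower2[of i]) auto
        qed
        then have "(SUP c\<in>U. INF i\<in>{1..CARD('n) + 1}. ereal (f (y i) c)) \<le> ereal v"
          by (rule SUP_least)
        moreover have "(x, y) \<in> (SIGMA x:X. {1..CARD('n) + 1} \<rightarrow>\<^sub>E R x)"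
          using \<open>x \<in> X\<close> y(1) s(2) by (auto simp: PiE_def Pi_def)
        ultimately show "k_adaptable_value (CARD('n) + 1) X R U f \<le> ereal v"
          unfolding k_adaptable_value_def by (intro INF_lower2) auto
      qed
    qed
  qed
qed

end
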